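(* Assume $\mu_i\ge1$ for all $i$. Consider the incidence-relation alternating projection (IAP) iteration: choose $a^{(0)}\in\mathcal{A}$, and for $k=0,1,2,\dots$ set $y_r^{(k)}=\Pi_{\mathcal{B}_r,\mu}(a_r^{(k)})$ for all $r\in[R]$, and $a^{(k+1)}_{r,i}=y^{(k)}_{r,i}-\mu_i^{-1}(Ay^{(k)})_i$ for $i\in S_r$, $a^{(k+1)}_{r,i}=0$ for $i\notin S_r$. Then for all $k\ge0$, $$d_{I(\mu)}(y^{(k)},\Xi)\le 2\,d_{I(\mu)}(y^{(0)},\Xi)\Big(1-\frac{1}{(\sqrt{N\|\mu\|_1/2}+1)^2}\Big)^k .$$ In particular, $d_{I(\mu)}(y^{(k)},\Xi)\le\epsilon$ after $O(N\|\mu\|_1\log(1/\epsilon))$ iterations.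
   Context: Let $N,R$ be positive integers. For each $r\in[R]$, $F_r:2^{[N]}\to\mathbb{R}$ is submodular with $F_r(\emptyset)=0$, with base polytope $\mathcal{B}_r=\{u\in\mathbb{R}^N:\sum_{i\in S}u_i\le F_r(S)\ \forall S,\ \sum_{i\in[N]}u_i=F_r([N])\}$ and Lovász extension $f_r(x)=\max_{u\in\mathcal{B}_r}\langle u,x\rangle$. $\mathcal{B}=\mathcal{B}_1\times\cdots\times\mathcal{B}_R\subseteq(\mathbb{R}^N)^R$; $A:(\mathbb{R}^N)^R\to\mathbb{R}^N$, $Ay=\sum_ry_r$. Element $i$ is incident to $F_r$ if $F_r(S\cup\{i\})\neq F_r(S)$ for some $S\subseteq[N]\setminus\{i\}$; $S_r$ is the set of elements incident to $F_r$; $\mu_i=|\{r:i\in S_r\}|$, $\mu=(\mu_1,\dots,\mu_N)$, $\|\mu\|_1=\sum_i\mu_i$. $\mathcal{A}=\{a\in(\mathbb{R}^N)^R: Aa=0,\ a_{r,i}=0\text{ whenever } i\notin S_r\}$. For $w\in\mathbb{R}^N_{>0}$, $\|z\|_{2,w}=\sqrt{\sum_iw_iz_i^2}$ and $\Pi_{\Omega,w}(u)=\arg\min_{z\in\Omega}\|z-u\|_{2,w}$. $I(w)\in(\mathbb{R}^N)^R$ has all blocks equal to $w$; $\|y\|_{2,\theta}=\sqrt{\sum_r\|y_r\|_{2,\theta_r}^2}$; $d_\theta(y,\mathcal{K})=\min_{z\in\mathcal{K}}\|y-z\|_{2,\theta}$. $x^*$ is the unique minimizer of $\sum_rf_r(x)+\frac12\|x\|_2^2$;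 $\Xi=\{\xi\in\mathcal{B}: A\xi=-x^*\}$ (the set of minimizers of $\|Ay\|_2^2$ over $\mathcal{B}$). *)

theory Defs
  imports Complex_Main
begin

text \<open>Ground set [N] is the finite type 'n (N = CARD('n)); index set [R] is the finite type 'r.
  Vectors in R^N are functions 'n \<Rightarrow> real; elements of (R^N)^R are functions 'r \<Rightarrow> 'n \<Rightarrow> real.\<close>

definition submodular :: "('n set \<Rightarrow> real) \<Rightarrow> bool" where
  "submodular F \<longleftrightarrow> (\<forall>S T. F (S \<union> T) + F (S \<inter> T) \<le> F S + F T)"

definition base_polytope :: "('n::finite set \<Rightarrow> real) \<Rightarrow> ('n \<Rightarrow> real) set" where
  "base_polytope F = {u. (\<forall>S. (\<Sum>i\<in>S. u i) \<le> F S) \<and> (\<Sum>i\<in>UNIV. u i) = F UNIV}"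

definition lovasz :: "('n::finite set \<Rightarrow> real) \<Rightarrow> ('n \<Rightarrow> real) \<Rightarrow> real" where
  "lovasz F x = Sup {(\<Sum>i\<in>UNIV. u i * x i) | u. u \<in> base_polytope F}"

definition incident :: "('n set \<Rightarrow> real) \<Rightarrow> 'n \<Rightarrow> bool" where
  "incident F i \<longleftrightarrow> (\<exists>S. i \<notin> S \<and> F (insert i S) \<noteq> F S)"

definition incset :: "('n set \<Rightarrow> real) \<Rightarrow> 'n set" where
  "incset F = {i. incident F i}"

definition mult :: "('r::finite \<Rightarrow> 'n set \<Rightarrow> real) \<Rightarrow> 'n \<Rightarrow> nat" where
  "mult F i = card {r. i \<in> incset (F r)}"

definition Aop :: "('r::finite \<Rightarrow> 'n \<Rightarrow> real) \<Rightarrow> 'n \<Rightarrow> real" where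
  "Aop y i = (\<Sum>r\<in>UNIV. y r i)"

definition Aset :: "('r::finite \<Rightarrow> 'n set \<Rightarrow> real) \<Rightarrow> ('r \<Rightarrow> 'n \<Rightarrow> real) set" where
  "Aset F = {a. Aop a = (\<lambda>_. 0) \<and> (\<forall>r i. i \<notin> incset (F r) \<longrightarrow> a r i = 0)}"

definition wnorm :: "('n::finite \<Rightarrow> real) \<Rightarrow> ('n \<Rightarrow> real) \<Rightarrow> real" where
  "wnorm w z = sqrt (\<Sum>i\<in>UNIV. w i * (z i)\<^sup>2)"

definition wproj :: "('n::finite \<Rightarrow> real) set \<Rightarrow> ('n \<Rightarrow> real) \<Rightarrow> ('n \<Rightarrow> real) \<Rightarrow> ('n \<Rightarrow> real)" where
  "wproj \<Omega> w u = (THE z. z \<in> \<Omega> \<and> (\<forall>z'\<in>\<Omega>. wnorm w (z - u) \<le> wnorm w (z' - u)))"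

definition Inorm :: "('n::finite \<Rightarrow> real) \<Rightarrow> ('r::finite \<Rightarrow> 'n \<Rightarrow> real) \<Rightarrow> real" where
  "Inorm w y = sqrt (\<Sum>r\<in>UNIV. (wnorm w (y r))\<^sup>2)"

definition Idist :: "('n::finite \<Rightarrow> real) \<Rightarrow> ('r::finite \<Rightarrow> 'n \<Rightarrow> real) \<Rightarrow> ('r \<Rightarrow> 'n \<Rightarrow> real) set \<Rightarrow> real" where
  "Idist w y K = Inf {Inorm w (y - z) | z. z \<in> K}"

definition Bprod :: "('r::finite \<Rightarrow> 'n::finite set \<Rightarrow> real) \<Rightarrow> ('r \<Rightarrow> 'n \<Rightarrow> real) set" where
  "Bprod F = {y. \<forall>r. y r \<in> base_polytope (F r)}"

definition xstar :: "('r::finite \<Rightarrow> 'n::finite set \<Rightarrow> real) \<Rightarrow> 'n \<Rightarrow> real" where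
  "xstar F = (THE x. \<forall>x'. (\<Sum>r\<in>UNIV. lovasz (F r) x) + (\<Sum>i\<in>UNIV. (x i)\<^sup>2) / 2
                       \<le> (\<Sum>r\<in>UNIV. lovasz (F r) x') + (\<Sum>i\<in>UNIV. (x' i)\<^sup>2) / 2)"

definition Xi :: "('r::finite \<Rightarrow> 'n::finite set \<Rightarrow> real) \<Rightarrow> ('r \<Rightarrow> 'n \<Rightarrow> real) set" where
  "Xi F = {\<xi> \<in> Bprod F. Aop \<xi> = - xstar F}"

end

theory Submission
  imports "HOL-Analysis.Analysis" Defs
begin

text \<open>Let s = -xstar, the point of least Euclidean norm among all Aop z with z in Bprod F.
  The iteration alternates projections between Bprod F and the affine space of vectors b with Aop b = s
  and incidence support, shifted by a vector orthogonal to Aset; the shift does not matter because s is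
  a minimum. Each projection from p to q satisfies |q - z|^2 + |p - q|^2 <= |p - z|^2 for z in Xi F, so it
  shrinks the squared distance to Xi F by 1 - 1/\<kappa>^2 as soon as this distance is at most \<kappa> |p - q|.

  The latter follows from the error bound: every y in Bprod F is within
  sqrt (N |\<mu>|_1 / 2) |Aop y - s| of Xi F. To prove it, minimize
  |u - y|^2 + \<beta> |Aop u - s|^2 over u in Bprod F. With p = \<beta> (s - Aop u), each block
  u r - y r - p is a linear functional minimized over its base polytope at u r, so its level sets are
  tight. Hence no upper level set of p loses mass in any block when passing from y to u, which
  bounds the mass moved through each element by half the l1 norm of Aop u - Aop y.\<close>

section \<open>Base polytopes\<close>

lemma base_polytope_sum_le: "u \<in> base_polytope F \<Longrightarrow> sum u S \<le> F S"
  and base_polytope_sum_UNIV: "u \<in> base_polytope F \<Longrightarrow> sum u UNIV = F UNIV"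
  by (auto simp: base_polytope_def)

text \<open>Edmonds' greedy algorithm: each new element receives its marginal value.\<close>

lemma greedy_vector_exists:
  fixes F :: "'n::finite set \<Rightarrow> real"
  assumes sub: "submodular F" and F0: "F {} = 0"
  shows "\<exists>u. (\<forall>T\<subseteq>A. sum u T \<le> F T) \<and> sum u A = F A"
  using finite[of A]
proof (induction A rule: finite_induct)
  case empty
  then show ?case using F0 by auto
next
  case (insert x A)
  then obtain u where u: "\<And>T. T \<subseteq> A \<Longrightarrow> sum u T \<le> F T" "sum u A = F A"
    by blast
  define v where "v = u(x := F (insert x A) - F A)"
  have vu: "sum v T = sum u T" if "x \<notin> T" for T
    unfolding v_def using that by (intro sum.cong) auto
  have "sum v T \<le> F T" if T: "T \<subseteq> insert x A" for T
  proof (cases "x \<in> T")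
    case False
    then show ?thesis using u(1)[of T] T vu[of T] by auto
  next
    case True
    define T0 where "T0 = T - {x}"
    have T0: "T = insert x T0" "x \<notin> T0" "T0 \<subseteq> A"
      using True T by (auto simp: T0_def)
    \<comment> \<open>Submodularity at A and T says that the marginal value of x over A is at most
      that over the smaller set \<open>T0\<close>.\<close>
    have "A \<union> T = insert x A" "A \<inter> T = T0"
      using T0 insert.hyps by auto
    then have "F (insert x A) + F T0 \<le> F A + F T"
      using sub by (metis submodular_def)
    moreover have "sum v T = v x + sum u T0"
      using T0 vu[of T0] by simp
    ultimately show ?thesis using u(1)[OF T0(3)] by (simp add: v_def)
  qed
  moreover have "sum v (insert x A) = F (insert x A)"
    using insert.hyps vu[of A] u(2) by (simp add: v_def)
  ultimately show ?case by blast
qed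

lemma base_polytope_nonempty:
  fixes F :: "'n::finite set \<Rightarrow> real"
  assumes "submodular F" "F {} = 0"
  shows "base_polytope F \<noteq> {}"
  using greedy_vector_exists[OF assms, of UNIV] by (auto simp: base_polytope_def)

lemma base_polytope_convex:
  assumes "u \<in> base_polytope F" "v \<in> base_polytope F" "0 \<le> t" "t \<le> 1"
  shows "(\<lambda>i. u i + t * (v i - u i)) \<in> base_polytope F"
proof -
  have eq: "(\<Sum>i\<in>S. u i + t * (v i - u i)) = (1 - t) * sum u S + t * sum v S" for S
    by (simp add: sum.distrib sum_subtractf flip: sum_distrib_left) (simp add: algebra_simps)
  have "(1 - t) * sum u S + t * sum v S \<le> (1 - t) * F S + t * F S" for S
    using assms by (intro add_mono mult_left_mono base_polytope_sum_le) auto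
  then show ?thesis
    using assms unfolding base_polytope_def mem_Collect_eq eq
    by (auto simp: algebra_simps)
qed

text \<open>The constraint on the complement of i, subtracted from the fixed total, gives the lower
  bound. These bounds yield compactness and pin down the nonincident coordinates.\<close>

lemma base_polytope_box:
  fixes F :: "'n::finite set \<Rightarrow> real"
  assumes "u \<in> base_polytope F"
  shows "F UNIV - F (UNIV - {i}) \<le> u i" "u i \<le> F {i}"
proof -
  have "sum u UNIV = u i + sum u (UNIV - {i})"
    by (simp add: sum.remove)
  then show "F UNIV - F (UNIV - {i}) \<le> u i"
    using base_polytope_sum_le[OF assms, of "UNIV - {i}"] base_polytope_sum_UNIV[OF assms] by linarith
  show "u i \<le> F {i}"
    using base_polytope_sum_le[OF assms, of "{i}"] by simp
qed

text \<open>Tychonoff's theorem, used both for coordinate boxes around a base polytope and for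
  \<open>Bprod\<close>, a product of base polytopes.\<close>

lemma compact_fun_box:
  fixes K :: "'a \<Rightarrow> 'b::topological_space set"
  assumes "\<And>i. compact (K i)"
  shows "compact {u. \<forall>i. u i \<in> K i}"
proof -
  have "compactin (product_topology (\<lambda>i. euclidean) UNIV) (PiE UNIV K)"
    using assms by (subst compactin_PiE) auto
  moreover have "PiE UNIV K = {u. \<forall>i. u i \<in> K i}"
    by (auto simp: PiE_def)
  ultimately show ?thesis
    by (simp add: euclidean_product_topology)
qed

lemma compact_base_polytope:
  fixes F :: "'n::finite set \<Rightarrow> real"
  shows "compact (base_polytope F)"
proof -
  have "closed {u :: 'n \<Rightarrow> real. sum u S \<le> F S}" for S
    by (intro closed_Collect_le continuous_intros continuous_on_product_coordinates)
  moreover have "closed {u :: 'n \<Rightarrow> real. sum u UNIV = F UNIV}"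
    by (intro closed_Collect_eq continuous_intros continuous_on_product_coordinates)
  moreover have "base_polytope F = (\<Inter>S. {u. sum u S \<le> F S}) \<inter> {u. sum u UNIV = F UNIV}"
    by (auto simp: base_polytope_def)
  ultimately have "closed (base_polytope F)"
    by (simp add: closed_INT closed_Int)
  moreover define K where "K = {u. \<forall>i. u i \<in> {F UNIV - F (UNIV - {i})..F {i}}}"
  have "compact K"
    unfolding K_def by (intro compact_fun_box) simp
  ultimately have "compact (K \<inter> base_polytope F)"
    by (intro compact_Int_closed)
  moreover have "base_polytope F \<subseteq> K"
    using base_polytope_box by (fastforce simp: K_def)
  ultimately show ?thesis
    by (simp only: Int_absorb1)
qed

text \<open>Both box bounds are marginal values of i, hence zero.\<close>

lemma base_polytope_nonincident:
  fixes F :: "'n::finite set \<Rightarrow> real"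
  assumes F0: "F {} = 0" and u: "u \<in> base_polytope F" and i: "i \<notin> incset F"
  shows "u i = 0"
proof -
  have eq: "F (insert i S) = F S" if "i \<notin> S" for S
    using i that by (auto simp: incset_def incident_def)
  have "F UNIV = F (UNIV - {i})"
    using eq[of "UNIV - {i}"] by (simp add: insert_UNIV insert_absorb)
  then show ?thesis
    using base_polytope_box[OF u, of i] eq[of "{}"] F0 by simp
qed

lemma compact_Bprod: "compact (Bprod F)"
  unfolding Bprod_def by (intro compact_fun_box compact_base_polytope)

lemma Bprod_nonempty:
  assumes "\<And>r. submodular (F r)" "\<And>r. F r {} = 0"
  shows "Bprod F \<noteq> {}"
proof -
  have "\<forall>r. \<exists>u. u \<in> base_polytope (F r)"
    using base_polytope_nonempty assms by blast
  then show ?thesis unfolding Bprod_def by (auto dest: choice)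
qed

lemma Bprod_convex:
  assumes "u \<in> Bprod F" "v \<in> Bprod F" "0 \<le> t" "t \<le> 1"
  shows "(\<lambda>r i. u r i + t * (v r i - u r i)) \<in> Bprod F"
  using assms base_polytope_convex unfolding Bprod_def by fastforce

section \<open>Tight sets\<close>

text \<open>The slacks of union and intersection are nonnegative, and by submodularity their sum is
  at most the sum of the slacks of S and T, which is zero.\<close>

lemma tight_Un_Int:
  assumes "submodular F" and u: "u \<in> base_polytope F"
    and "sum u S = F S" "sum u T = F T"
  shows "sum u (S \<union> T) = F (S \<union> T)" "sum u (S \<inter> T) = F (S \<inter> T)"
proof -
  have "sum u (S \<union> T) + sum u (S \<inter> T) = sum u S + sum u T"
    by (simp add: sum.union_inter)
  moreover have "F (S \<union> T) + F (S \<inter> T) \<le> F S + F T"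
    using assms(1) by (auto simp: submodular_def)
  ultimately show "sum u (S \<union> T) = F (S \<union> T)" "sum u (S \<inter> T) = F (S \<inter> T)"
    using base_polytope_sum_le[OF u, of "S \<union> T"] base_polytope_sum_le[OF u, of "S \<inter> T"] assms(3,4)
    by linarith+
qed

lemma tight_UN:
  fixes T :: "'i::finite \<Rightarrow> 'n::finite set"
  assumes "submodular F" "F {} = 0" "u \<in> base_polytope F"
    and "\<And>i. i \<in> I \<Longrightarrow> sum u (T i) = F (T i)"
  shows "sum u (\<Union>i\<in>I. T i) = F (\<Union>i\<in>I. T i)"
  using finite[of I] assms(4)
proof (induction I rule: finite_induct)
  case (insert x I)
  then show ?case using tight_Un_Int(1)[OF assms(1,3)] by simp
qed (simp add: assms(2))

lemma tight_INT:
  fixes T :: "'i::finite \<Rightarrow> 'n::finite set"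
  assumes "submodular F" "u \<in> base_polytope F"
    and "\<And>i. i \<in> I \<Longrightarrow> sum u (T i) = F (T i)"
  shows "sum u (\<Inter>i\<in>I. T i) = F (\<Inter>i\<in>I. T i)"
  using finite[of I] assms(3)
proof (induction I rule: finite_induct)
  case (insert x I)
  then show ?case using tight_Un_Int(2)[OF assms(1,2)] by simp
qed (simp add: base_polytope_sum_UNIV[OF assms(2)])

text \<open>If no tight set contained i and missed j, some mass could be moved from j to i inside
  the polytope, which lowers the functional g.\<close>

lemma linear_min_exchange_tight:
  fixes F :: "'n::finite set \<Rightarrow> real"
  assumes u: "u \<in> base_polytope F"
    and opt: "\<And>z. z \<in> base_polytope F \<Longrightarrow> 0 \<le> (\<Sum>i\<in>UNIV. g i * (z i - u i))"
    and lt: "g i < g j"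
  shows "\<exists>T. i \<in> T \<and> j \<notin> T \<and> sum u T = F T"
proof (rule ccontr)
  assume no: "\<not> ?thesis"
  define \<T> where "\<T> = {T. i \<in> T \<and> j \<notin> T}"
  \<comment> \<open>The least slack among the sets that gain mass under the exchange, so the
    exchange by e stays feasible.\<close>
  define e where "e = Min ((\<lambda>T. F T - sum u T) ` \<T>)"
  have ij: "i \<noteq> j" using lt by auto
  have fin: "finite ((\<lambda>T. F T - sum u T) ` \<T>)" by simp
  have "{i} \<in> \<T>" using ij by (auto simp: \<T>_def)
  then have ne: "(\<lambda>T. F T - sum u T) ` \<T> \<noteq> {}" by blast
  have "0 < F T - sum u T" if "T \<in> \<T>" for T
    using that no base_polytope_sum_le[OF u, of T] unfolding \<T>_def by fastforce
  then have e_pos: "0 < e"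
    unfolding e_def using fin ne by (subst Min_gr_iff) auto
  have e_le: "e \<le> F T - sum u T" if "T \<in> \<T>" for T
    unfolding e_def using fin that by (intro Min_le) auto
  define z where "z = (\<lambda>k. u k + ((if k = i then e else 0) - (if k = j then e else 0)))"
  have sum_z: "sum z T = sum u T + ((if i \<in> T then e else 0) - (if j \<in> T then e else 0))" for T
    by (simp add: z_def sum.distrib sum_subtractf)
  have "sum z T \<le> F T" for T
    using e_le[of T] e_pos base_polytope_sum_le[OF u, of T] by (auto simp: sum_z \<T>_def)
  then have "z \<in> base_polytope F"
    using base_polytope_sum_UNIV[OF u] sum_z[of UNIV] by (auto simp: base_polytope_def)
  moreover have "g k * (z k - u k) = (if k = i then g k * e else 0) - (if k = j then g k * e else 0)" for k
    by (simp add: z_def)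
  ultimately have "0 \<le> (\<Sum>k\<in>UNIV. (if k = i then g k * e else 0) - (if k = j then g k * e else 0))"
    using opt[of z] by simp
  then have "0 \<le> (g i - g j) * e"
    by (simp add: sum_subtractf algebra_simps)
  then show False using lt e_pos by (simp add: zero_le_mult_iff)
qed

text \<open>Tight sets form a lattice, and L is a union of intersections of the tight sets that
  separate its elements from those outside.\<close>

lemma linear_min_level_set_tight:
  fixes F :: "'n::finite set \<Rightarrow> real"
  assumes sub: "submodular F" and F0: "F {} = 0" and u: "u \<in> base_polytope F"
    and opt: "\<And>z. z \<in> base_polytope F \<Longrightarrow> 0 \<le> (\<Sum>i\<in>UNIV. g i * (z i - u i))"
    and L: "\<And>i j. i \<in> L \<Longrightarrow> j \<notin> L \<Longrightarrow> g i < g j"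
  shows "sum u L = F L"
proof -
  have "\<forall>i\<in>L. \<forall>j\<in>-L. \<exists>T. i \<in> T \<and> j \<notin> T \<and> sum u T = F T"
    using linear_min_exchange_tight[OF u opt L] by auto
  then obtain T where T: "\<And>i j. i \<in> L \<Longrightarrow> j \<notin> L \<Longrightarrow> i \<in> T i j \<and> j \<notin> T i j \<and> sum u (T i j) = F (T i j)"
    unfolding bchoice_iff by (metis Compl_iff)
  have "sum u (\<Union>i\<in>L. \<Inter>j\<in>-L. T i j) = F (\<Union>i\<in>L. \<Inter>j\<in>-L. T i j)"
    using T by (intro tight_UN tight_INT sub F0 u) auto
  moreover have "(\<Union>i\<in>L. \<Inter>j\<in>-L. T i j) = L"
    using T by blast
  ultimately show ?thesis by simp
qed

section \<open>Quadratic minimization over base polytopes\<close>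

text \<open>L is the one-sided derivative at 0 of a quadratic that is nonnegative on (0, 1]; this
  turns minimality along segments into variational inequalities.\<close>

lemma first_order_nonneg:
  fixes L Q :: real
  assumes "\<And>t. 0 < t \<Longrightarrow> t \<le> 1 \<Longrightarrow> 0 \<le> t * L + t\<^sup>2 * Q"
  shows "0 \<le> L"
proof (rule ccontr)
  assume "\<not> 0 \<le> L"
  \<comment> \<open>This choice keeps t |Q| below half of -L, so the linear term dominates.\<close>
  define t where "t = min 1 (- L / (2 * (\<bar>Q\<bar> + 1)))"
  have t: "0 < t" "t \<le> 1" "t \<le> - L / (2 * (\<bar>Q\<bar> + 1))"
    using \<open>\<not> 0 \<le> L\<close> by (auto simp: t_def intro!: divide_neg_pos)
  then have tL: "t * (2 * (\<bar>Q\<bar> + 1)) \<le> - L"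
    by (subst (asm) pos_le_divide_eq) auto
  have "0 \<le> t * (L + t * Q)"
    using assms[OF t(1,2)] by (simp add: power2_eq_square algebra_simps)
  then have "0 \<le> L + t * Q"
    using t(1) by (simp add: zero_le_mult_iff)
  moreover have "t * Q \<le> t * \<bar>Q\<bar>"
    using t(1) by (intro mult_left_mono) auto
  moreover have "0 \<le> t * \<bar>Q\<bar>" using t(1) by simp
  moreover have "2 * t + 2 * (t * \<bar>Q\<bar>) \<le> - L" using tL by (simp add: algebra_simps)
  ultimately show False using t(1) by linarith
qed

lemma continuous_on_coordinate: "continuous_on S (\<lambda>u. u i)"
  using continuous_on_product_then_coordinatewise[OF continuous_on_id] .

lemma continuous_on_entry [continuous_intros]: "continuous_on S (\<lambda>u. u r i)"
  using continuous_on_product_then_coordinatewise[OF continuous_on_coordinate] .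

lemma continuous_on_Aop [continuous_intros]: "continuous_on S (\<lambda>u. Aop u i)"
  unfolding Aop_def by (intro continuous_intros)

lemma wnorm_le_iff:
  "(\<And>i. 0 \<le> w i) \<Longrightarrow> wnorm w u \<le> wnorm w v \<longleftrightarrow> (\<Sum>i\<in>UNIV. w i * (u i)\<^sup>2) \<le> (\<Sum>i\<in>UNIV. w i * (v i)\<^sup>2)"
  by (simp add: wnorm_def)

lemma wnorm_minimizer_first_order:
  fixes F :: "'n::finite set \<Rightarrow> real"
  assumes w: "\<And>i. 0 < w i" and q: "q \<in> base_polytope F"
    and min: "\<And>z. z \<in> base_polytope F \<Longrightarrow> wnorm w (q - a) \<le> wnorm w (z - a)"
    and z: "z \<in> base_polytope F"
  shows "0 \<le> (\<Sum>i\<in>UNIV. w i * (q i - a i) * (z i - q i))"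
proof -
  have "0 \<le> t * (2 * (\<Sum>i\<in>UNIV. w i * (q i - a i) * (z i - q i))) + t\<^sup>2 * (\<Sum>i\<in>UNIV. w i * (z i - q i)\<^sup>2)"
    if t: "0 < t" "t \<le> 1" for t
  proof -
    have "(\<lambda>i. q i + t * (z i - q i)) \<in> base_polytope F"
      using base_polytope_convex[OF q z] t by auto
    from min[OF this] have "(\<Sum>i\<in>UNIV. w i * (q i - a i)\<^sup>2) \<le> (\<Sum>i\<in>UNIV. w i * (q i + t * (z i - q i) - a i)\<^sup>2)"
      using w by (simp add: wnorm_le_iff less_imp_le)
    also have "\<dots> = (\<Sum>i\<in>UNIV. w i * (q i - a i)\<^sup>2) + t * (2 * (\<Sum>i\<in>UNIV. w i * (q i - a i) * (z i - q i)))
        + t\<^sup>2 * (\<Sum>i\<in>UNIV. w i * (z i - q i)\<^sup>2)"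
      by (simp add: sum_distrib_left flip: sum.distrib) (simp add: power2_eq_square algebra_simps)
    finally show ?thesis by linarith
  qed
  from first_order_nonneg[OF this] show ?thesis by simp
qed

text \<open>The \<open>THE\<close> in \<open>wproj\<close> is justified: a minimizer exists by
  compactness, and the variational inequalities of two minimizers, each tested at the other, add up
  to a nonpositive squared distance.\<close>

lemma
  fixes F :: "'n::finite set \<Rightarrow> real"
  assumes "submodular F" "F {} = 0" and w: "\<And>i. 0 < w i"
  shows wproj_mem: "wproj (base_polytope F) w a \<in> base_polytope F"
    and wproj_first_order: "z \<in> base_polytope F \<Longrightarrow>
      0 \<le> (\<Sum>i\<in>UNIV. w i * (wproj (base_polytope F) w a i - a i) * (z i - wproj (base_polytope F) w a i))"
proof -
  define P where "P q \<longleftrightarrow> q \<in> base_polytope F \<and> (\<forall>z\<in>base_polytope F. wnorm w (q - a) \<le> wnorm w (z - a))" for q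
  have "continuous_on (base_polytope F) (\<lambda>z. wnorm w (z - a))"
    unfolding wnorm_def minus_apply
    by (intro continuous_intros continuous_on_coordinate)
  then have "\<exists>q. P q"
    unfolding P_def using continuous_attains_inf[OF compact_base_polytope base_polytope_nonempty[OF assms(1,2)]] by blast
  moreover have "q1 = q2" if "P q1" "P q2" for q1 q2
  proof -
    have "0 \<le> (\<Sum>i\<in>UNIV. w i * (q1 i - a i) * (q2 i - q1 i))" "0 \<le> (\<Sum>i\<in>UNIV. w i * (q2 i - a i) * (q1 i - q2 i))"
      using that w by (auto simp: P_def intro!: wnorm_minimizer_first_order)
    then have "0 \<le> (\<Sum>i\<in>UNIV. w i * (q1 i - a i) * (q2 i - q1 i)) + (\<Sum>i\<in>UNIV. w i * (q2 i - a i) * (q1 i - q2 i))"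
      by linarith
    also have "\<dots> = - (\<Sum>i\<in>UNIV. w i * (q1 i - q2 i)\<^sup>2)"
      by (simp flip: sum.distrib sum_negf) (simp add: power2_eq_square algebra_simps)
    finally have "(\<Sum>i\<in>UNIV. w i * (q1 i - q2 i)\<^sup>2) \<le> 0" by simp
    then have "(\<Sum>i\<in>UNIV. w i * (q1 i - q2 i)\<^sup>2) = 0"
      using w by (intro antisym sum_nonneg mult_nonneg_nonneg) (auto intro: less_imp_le)
    then have "\<forall>i. w i * (q1 i - q2 i)\<^sup>2 = 0"
      using w by (subst (asm) sum_nonneg_eq_0_iff) (auto simp: less_imp_le)
    then show "q1 = q2" using w by (auto simp: less_le)
  qed
  ultimately have "P (wproj (base_polytope F) w a)"
    unfolding wproj_def P_def[symmetric] by (metis theI)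
  then show "wproj (base_polytope F) w a \<in> base_polytope F"
    and "z \<in> base_polytope F \<Longrightarrow>
      0 \<le> (\<Sum>i\<in>UNIV. w i * (wproj (base_polytope F) w a i - a i) * (z i - wproj (base_polytope F) w a i))"
    using w by (auto simp: P_def intro!: wnorm_minimizer_first_order)
qed

text \<open>It serves twice: with \<alpha> = 0 and s = 0 its minimizer yields \<open>xstar\<close>,
  and with \<alpha> = 1 and large \<beta> it approximates the projection of y onto the points with
  \<open>Aop u = s\<close>.\<close>

definition penalty :: "real \<Rightarrow> real \<Rightarrow> ('r::finite \<Rightarrow> 'n::finite \<Rightarrow> real) \<Rightarrow> ('n \<Rightarrow> real) \<Rightarrow> ('r \<Rightarrow> 'n \<Rightarrow> real) \<Rightarrow> real" where
  "penalty \<alpha> \<beta> y s u = \<alpha> * (\<Sum>r\<in>UNIV. \<Sum>i\<in>UNIV. (u r i - y r i)\<^sup>2) + \<beta> * (\<Sum>i\<in>UNIV. (Aop u i - s i)\<^sup>2)"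

lemma penalty_minimizer:
  fixes F :: "'r::finite \<Rightarrow> 'n::finite set \<Rightarrow> real"
  assumes sub: "\<And>r. submodular (F r)" and F0: "\<And>r. F r {} = 0"
  obtains u where "u \<in> Bprod F" "\<And>z. z \<in> Bprod F \<Longrightarrow> penalty \<alpha> \<beta> y s u \<le> penalty \<alpha> \<beta> y s z"
    "\<And>r z. z \<in> base_polytope (F r) \<Longrightarrow>
       0 \<le> (\<Sum>i\<in>UNIV. (\<alpha> * (u r i - y r i) + \<beta> * (Aop u i - s i)) * (z i - u r i))"
proof -
  have "continuous_on (Bprod F) (penalty \<alpha> \<beta> y s)"
    unfolding penalty_def by (intro continuous_intros)
  then obtain u where u: "u \<in> Bprod F" "\<And>z. z \<in> Bprod F \<Longrightarrow> penalty \<alpha> \<beta> y s u \<le> penalty \<alpha> \<beta> y s z"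
    using continuous_attains_inf[OF compact_Bprod Bprod_nonempty[of F, OF sub F0]] by blast
  moreover have "0 \<le> (\<Sum>i\<in>UNIV. (\<alpha> * (u r i - y r i) + \<beta> * (Aop u i - s i)) * (z i - u r i))" (is "0 \<le> ?L")
    if z: "z \<in> base_polytope (F r)" for r z
  proof -
    define d where "d i = z i - u r i" for i
    have "0 \<le> t * (2 * ?L) + t\<^sup>2 * ((\<alpha> + \<beta>) * (\<Sum>i\<in>UNIV. (d i)\<^sup>2))" if t: "0 < t" "t \<le> 1" for t
    proof -
      \<comment> \<open>Only block r moves, so \<open>Aop\<close> moves by the same t d, and one
        common vector \<beta> (Aop u - s) appears in the optimality condition of every
        block.\<close>
      define v where "v = u(r := (\<lambda>i. u r i + t * d i))"
      have "v \<in> Bprod F"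
        using u(1) base_polytope_convex[of "u r" "F r" z t] z t by (auto simp: Bprod_def v_def d_def)
      then have le: "penalty \<alpha> \<beta> y s u \<le> penalty \<alpha> \<beta> y s v" by (rule u(2))
      have split: "(\<Sum>r'\<in>UNIV. f (v r') r') = (\<Sum>r'\<in>UNIV. f (u r') r') + f (v r) r - f (u r) r"
        for f :: "('n \<Rightarrow> real) \<Rightarrow> 'r \<Rightarrow> real"
      proof -
        have "(\<Sum>r'\<in>UNIV - {r}. f (v r') r') = (\<Sum>r'\<in>UNIV - {r}. f (u r') r')"
          by (intro sum.cong) (auto simp: v_def)
        then show ?thesis by (simp add: sum.remove[of UNIV r])
      qed
      have A: "Aop v i = Aop u i + t * d i" for i
        unfolding Aop_def using split[of "\<lambda>x _. x i"] by (simp add: v_def)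
      have "penalty \<alpha> \<beta> y s v - penalty \<alpha> \<beta> y s u =
          \<alpha> * ((\<Sum>i\<in>UNIV. (v r i - y r i)\<^sup>2) - (\<Sum>i\<in>UNIV. (u r i - y r i)\<^sup>2))
          + \<beta> * ((\<Sum>i\<in>UNIV. (Aop v i - s i)\<^sup>2) - (\<Sum>i\<in>UNIV. (Aop u i - s i)\<^sup>2))"
        unfolding penalty_def split[of "\<lambda>x r'. \<Sum>i\<in>UNIV. (x i - y r' i)\<^sup>2"]
        by (simp add: algebra_simps)
      also have "\<dots> = t * (2 * ?L) + t\<^sup>2 * ((\<alpha> + \<beta>) * (\<Sum>i\<in>UNIV. (d i)\<^sup>2))"
        unfolding A d_def[symmetric]
        by (simp add: v_def sum_distrib_left flip: sum.distrib sum_subtractf)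
          (intro sum.cong refl, simp add: power2_eq_square algebra_simps)
      finally show ?thesis using le by linarith
    qed
    from first_order_nonneg[OF this] show ?thesis by simp
  qed
  ultimately show thesis by (rule that)
qed

section \<open>The error bound\<close>

text \<open>The set of indices where u - y < p - t is tight, and its symmetric difference with Q only
  involves entries whose sign favours the claim.\<close>

lemma upper_level_set_gain:
  fixes F :: "'n::finite set \<Rightarrow> real"
  assumes sub: "submodular F" and F0: "F {} = 0"
    and u: "u \<in> base_polytope F" and y: "y \<in> base_polytope F"
    and opt: "\<And>z. z \<in> base_polytope F \<Longrightarrow> 0 \<le> (\<Sum>i\<in>UNIV. (u i - y i - p i) * (z i - u i))"
    and Q: "\<And>i. i \<in> Q \<Longrightarrow> t \<le> p i" "\<And>i. i \<notin> Q \<Longrightarrow> p i \<le> t"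
  shows "0 \<le> (\<Sum>i\<in>Q. u i - y i)"
proof -
  define T where "T = {i. u i - y i - p i < - t}"
  have "sum u T = F T"
    unfolding T_def by (rule linear_min_level_set_tight[OF sub F0 u opt]) auto
  then have "0 \<le> (\<Sum>i\<in>T. u i - y i)"
    using base_polytope_sum_le[OF y, of T] by (simp add: sum_subtractf)
  moreover have "0 \<le> (\<Sum>i\<in>Q - T. u i - y i)"
  proof (rule sum_nonneg)
    fix i assume "i \<in> Q - T"
    then show "0 \<le> u i - y i" using Q(1)[of i] by (auto simp: T_def)
  qed
  moreover have "(\<Sum>i\<in>T - Q. u i - y i) \<le> 0"
  proof (rule sum_nonpos)
    fix i assume "i \<in> T - Q"
    then show "u i - y i \<le> 0" using Q(2)[of i] by (auto simp: T_def)
  qed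
  moreover have "sum f Q + sum f (T - Q) = sum f T + sum f (Q - T)" for f :: "'n \<Rightarrow> real"
  proof -
    have "sum f Q = sum f (Q \<inter> T) + sum f (Q - T)" "sum f T = sum f (T \<inter> Q) + sum f (T - Q)"
      by (simp_all add: sum.Int_Diff[symmetric])
    then show ?thesis by (simp add: Int_commute)
  qed
  from this[of "\<lambda>i. u i - y i"] show ?thesis using calculation by linarith
qed

text \<open>With total zero, the positive and the negative parts each carry half of the absolute
  sum.\<close>

lemma sum_le_half_abs_sum:
  fixes f :: "'a::finite \<Rightarrow> real"
  assumes "sum f UNIV = 0"
  shows "sum f X \<le> (\<Sum>i\<in>UNIV. \<bar>f i\<bar>) / 2"
proof -
  have split: "sum g UNIV = sum g X + sum g (- X)" for g :: "'a \<Rightarrow> real"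
    using sum.Int_Diff[of UNIV g X] by (simp add: Compl_eq_Diff_UNIV)
  have "sum f X \<le> (\<Sum>i\<in>X. \<bar>f i\<bar>)" "- sum f (- X) \<le> (\<Sum>i\<in>- X. \<bar>f i\<bar>)"
    by (auto simp flip: sum_negf intro!: sum_mono)
  then show ?thesis
    using assms split[of f] split[of "\<lambda>i. \<bar>f i\<bar>"] by linarith
qed

lemma sum_squares_le_squared_sum:
  fixes f :: "'a \<Rightarrow> real"
  assumes "\<And>i. i \<in> A \<Longrightarrow> 0 \<le> f i"
  shows "(\<Sum>i\<in>A. (f i)\<^sup>2) \<le> (sum f A)\<^sup>2"
proof -
  have "L2_set f A \<le> sum f A" using assms by (rule L2_set_le_sum)
  then have "(L2_set f A)\<^sup>2 \<le> (sum f A)\<^sup>2" by (intro power_mono) auto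
  then show ?thesis by (simp add: L2_set_def sum_nonneg)
qed

text \<open>Read D as a flow in which element i passes mass only into X: the net gain of X bounds what i
  gives away, and the net gain of X with i bounds what i receives.\<close>

lemma column_norm_bound:
  fixes D :: "'r::finite \<Rightarrow> 'n::finite \<Rightarrow> real"
  assumes "i \<notin> X" and X: "\<And>r. 0 \<le> sum (D r) X" and iX: "\<And>r. 0 \<le> sum (D r) (insert i X)"
    and zero: "sum (Aop D) UNIV = 0"
  shows "(\<Sum>r\<in>UNIV. (D r i)\<^sup>2) \<le> (\<Sum>i\<in>UNIV. \<bar>Aop D i\<bar>)\<^sup>2 / 2"
proof -
  define S where "S = (\<Sum>i\<in>UNIV. \<bar>Aop D i\<bar>) / 2"
  define P N where "P r = max 0 (D r i)" and "N r = max 0 (- D r i)" for r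
  have sumA: "sum (Aop D) Y = (\<Sum>r\<in>UNIV. sum (D r) Y)" for Y
    unfolding Aop_def by (rule sum.swap)
  \<comment> \<open>Adding i to X changes the gain by D r i and leaves it nonnegative, so block r
    cannot take more from i than X gains.\<close>
  have "N r \<le> sum (D r) X" for r
    using X[of r] iX[of r] \<open>i \<notin> X\<close> by (auto simp: N_def)
  then have "sum N UNIV \<le> sum (Aop D) X"
    unfolding sumA by (rule sum_mono)
  then have N: "sum N UNIV \<le> S"
    using sum_le_half_abs_sum[OF zero, of X] by (simp add: S_def)
  have "P r \<le> sum (D r) (insert i X)" for r
    using X[of r] iX[of r] \<open>i \<notin> X\<close> by (auto simp: P_def)
  then have "sum P UNIV \<le> sum (Aop D) (insert i X)"
    unfolding sumA by (rule sum_mono)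
  then have P: "sum P UNIV \<le> S"
    using sum_le_half_abs_sum[OF zero, of "insert i X"] by (simp add: S_def)
  have nonneg: "0 \<le> P r" "0 \<le> N r" for r by (auto simp: P_def N_def)
  \<comment> \<open>In each block at most one of P r and N r is nonzero.\<close>
  have "(\<Sum>r\<in>UNIV. (D r i)\<^sup>2) = (\<Sum>r\<in>UNIV. (P r)\<^sup>2) + (\<Sum>r\<in>UNIV. (N r)\<^sup>2)"
    unfolding sum.distrib[symmetric] by (intro sum.cong) (auto simp: P_def N_def max_def)
  also have "\<dots> \<le> (sum P UNIV)\<^sup>2 + (sum N UNIV)\<^sup>2"
    using nonneg by (intro add_mono sum_squares_le_squared_sum)
  also have "\<dots> \<le> S\<^sup>2 + S\<^sup>2"
    using nonneg P N by (intro add_mono power_mono sum_nonneg) auto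
  also have "\<dots> = (\<Sum>i\<in>UNIV. \<bar>Aop D i\<bar>)\<^sup>2 / 2"
    by (simp add: S_def power_divide)
  finally show ?thesis .
qed

lemma Aop_minus: "Aop (\<lambda>r i. u r i - v r i) = (\<lambda>i. Aop u i - Aop v i)"
  by (simp add: Aop_def fun_eq_iff sum_subtractf)

lemma sum_Aop_Bprod:
  assumes "u \<in> Bprod F"
  shows "sum (Aop u) UNIV = (\<Sum>r\<in>UNIV. F r UNIV)"
proof -
  have "sum (Aop u) UNIV = (\<Sum>r\<in>UNIV. sum (u r) UNIV)"
    unfolding Aop_def by (rule sum.swap)
  also have "\<dots> = (\<Sum>r\<in>UNIV. F r UNIV)"
    using assms by (intro sum.cong refl base_polytope_sum_UNIV) (auto simp: Bprod_def)
  finally show ?thesis .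
qed

text \<open>Since p is the same for all blocks, its upper level sets gain mass in every block at
  once, and the column bound applies to each element.\<close>

lemma penalty_minimizer_bound:
  fixes F :: "'r::finite \<Rightarrow> 'n::finite set \<Rightarrow> real"
  assumes sub: "\<And>r. submodular (F r)" and F0: "\<And>r. F r {} = 0"
    and u: "u \<in> Bprod F" and y: "y \<in> Bprod F"
    and opt: "\<And>r z. z \<in> base_polytope (F r) \<Longrightarrow>
       0 \<le> (\<Sum>i\<in>UNIV. (u r i - y r i - p i) * (z i - u r i))"
    and w: "\<And>i. 0 \<le> w i"
  shows "(\<Sum>r\<in>UNIV. \<Sum>i\<in>UNIV. w i * (u r i - y r i)\<^sup>2)
    \<le> sum w UNIV * (\<Sum>i\<in>UNIV. \<bar>Aop u i - Aop y i\<bar>)\<^sup>2 / 2"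
proof -
  define D where "D r i = u r i - y r i" for r i
  have AD: "Aop D = (\<lambda>i. Aop u i - Aop y i)"
    unfolding D_def by (rule Aop_minus)
  have gain: "0 \<le> sum (D r) Q" if "\<And>i. i \<in> Q \<Longrightarrow> t \<le> p i" "\<And>i. i \<notin> Q \<Longrightarrow> p i \<le> t" for r Q t
    unfolding D_def using u y opt that
    by (intro upper_level_set_gain[OF sub F0, of "u r" r "y r" p Q t]) (auto simp: Bprod_def)
  have "sum (Aop D) UNIV = 0"
    unfolding AD sum_subtractf using sum_Aop_Bprod[OF u] sum_Aop_Bprod[OF y] by simp
  then have col: "(\<Sum>r\<in>UNIV. (D r i)\<^sup>2) \<le> (\<Sum>i\<in>UNIV. \<bar>Aop D i\<bar>)\<^sup>2 / 2" for i
    \<comment> \<open>The threshold p i admits both the strict upper level set and that set with i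
      added, even when other elements tie with i.\<close>
    by (intro column_norm_bound[where X = "{j. p i < p j}"] gain[of _ "p i"]) auto
  have "(\<Sum>r\<in>UNIV. \<Sum>i\<in>UNIV. w i * (D r i)\<^sup>2) = (\<Sum>i\<in>UNIV. w i * (\<Sum>r\<in>UNIV. (D r i)\<^sup>2))"
    unfolding sum_distrib_left by (rule sum.swap)
  also have "\<dots> \<le> (\<Sum>i\<in>UNIV. w i * ((\<Sum>i\<in>UNIV. \<bar>Aop D i\<bar>)\<^sup>2 / 2))"
    using col w by (intro sum_mono mult_left_mono) auto
  finally show ?thesis
    unfolding AD D_def by (simp add: sum_distrib_right sum_divide_distrib)
qed

text \<open>Minimizing the penalized objective with growing weight on Aop u - s meets the constraint only
  in the limit; the limit is replaced by a minimum over the compact set of points satisfying the bound.\<close>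

lemma Bprod_error_bound_abs:
  fixes F :: "'r::finite \<Rightarrow> 'n::finite set \<Rightarrow> real"
  assumes sub: "\<And>r. submodular (F r)" and F0: "\<And>r. F r {} = 0"
    and y: "y \<in> Bprod F" and x: "x \<in> Bprod F" and w: "\<And>i. 0 \<le> w i"
  obtains u where "u \<in> Bprod F" "Aop u = Aop x"
    "(\<Sum>r\<in>UNIV. \<Sum>i\<in>UNIV. w i * (u r i - y r i)\<^sup>2)
       \<le> sum w UNIV * (\<Sum>i\<in>UNIV. \<bar>Aop x i - Aop y i\<bar>)\<^sup>2 / 2"
proof -
  define G where "G = {u. (\<Sum>r\<in>UNIV. \<Sum>i\<in>UNIV. w i * (u r i - y r i)\<^sup>2)
    \<le> sum w UNIV * (\<Sum>i\<in>UNIV. \<bar>Aop u i - Aop y i\<bar>)\<^sup>2 / 2}"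
  define K where "K = Bprod F \<inter> G"
  define h where "h u = (\<Sum>i\<in>UNIV. (Aop u i - Aop x i)\<^sup>2)" for u :: "'r \<Rightarrow> 'n \<Rightarrow> real"
  have "closed G"
    unfolding G_def by (intro closed_Collect_le continuous_intros) auto
  then have "compact K"
    unfolding K_def by (intro compact_Int_closed compact_Bprod)
  moreover have "continuous_on K h"
    unfolding h_def by (intro continuous_intros)
  \<comment> \<open>Both sides of the bound vanish at y, so K is nonempty.\<close>
  moreover have "y \<in> K" using y by (simp add: K_def G_def)
  ultimately obtain u where u: "u \<in> K" "\<And>v. v \<in> K \<Longrightarrow> h u \<le> h v"
    using continuous_attains_inf[of K h] by blast
  have "h u = 0"
  proof (rule ccontr)
    assume "h u \<noteq> 0"
    then have pos: "0 < h u" unfolding h_def by (simp add: less_le sum_nonneg)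
    define E where "E v = (\<Sum>r\<in>UNIV. \<Sum>i\<in>UNIV. (v r i - y r i)\<^sup>2)" for v :: "'r \<Rightarrow> 'n \<Rightarrow> real"
    have E: "0 \<le> E v" for v unfolding E_def by (intro sum_nonneg) auto
    \<comment> \<open>With this weight \<beta> h u exceeds E x, the penalized value of the feasible
      point x. The penalized minimizer v also lies in K, so h u \<le> h v gives a
      contradiction.\<close>
    define \<beta> where "\<beta> = (E x + 1) / h u"
    have \<beta>: "0 < \<beta>" using pos E[of x] by (simp add: \<beta>_def)
    obtain v where v: "v \<in> Bprod F"
      and min: "\<And>z. z \<in> Bprod F \<Longrightarrow> penalty 1 \<beta> y (Aop x) v \<le> penalty 1 \<beta> y (Aop x) z"
      and opt: "\<And>r z. z \<in> base_polytope (F r) \<Longrightarrow>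
       0 \<le> (\<Sum>i\<in>UNIV. (1 * (v r i - y r i) + \<beta> * (Aop v i - Aop x i)) * (z i - v r i))"
      using penalty_minimizer[of F 1 \<beta> y "Aop x", OF sub F0] by blast
    have "v \<in> G"
      unfolding G_def mem_Collect_eq
      using opt w v y
      by (intro penalty_minimizer_bound[OF sub F0, where p = "\<lambda>i. - \<beta> * (Aop v i - Aop x i)"]) auto
    then have "h u \<le> h v" using u(2) v by (simp add: K_def)
    have "E v + \<beta> * h v \<le> E x"
      using min[OF x] by (simp add: penalty_def E_def h_def)
    then have "\<beta> * h v \<le> E x" using E[of v] by linarith
    moreover have "\<beta> * h u \<le> \<beta> * h v" using \<open>h u \<le> h v\<close> \<beta> by simp
    moreover have "\<beta> * h u = E x + 1" using pos by (simp add: \<beta>_def)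
    ultimately show False by linarith
  qed
  then have "\<forall>i. Aop u i - Aop x i = 0"
    unfolding h_def by (subst (asm) sum_nonneg_eq_0_iff) auto
  then have A: "Aop u = Aop x" by (simp add: fun_eq_iff)
  have "u \<in> Bprod F" "u \<in> G" using u(1) by (auto simp: K_def)
  then show thesis using that[of u] A by (simp add: G_def)
qed

text \<open>Cauchy-Schwarz replaces the l1 norm by the Euclidean norm at the cost of the factor
  N.\<close>

lemma Bprod_error_bound:
  fixes F :: "'r::finite \<Rightarrow> 'n::finite set \<Rightarrow> real"
  assumes sub: "\<And>r. submodular (F r)" and F0: "\<And>r. F r {} = 0"
    and y: "y \<in> Bprod F" and x: "x \<in> Bprod F" and w: "\<And>i. 0 \<le> w i"
  obtains u where "u \<in> Bprod F" "Aop u = Aop x"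
    "(\<Sum>r\<in>UNIV. \<Sum>i\<in>UNIV. w i * (u r i - y r i)\<^sup>2)
       \<le> real CARD('n) * sum w UNIV / 2 * (\<Sum>i\<in>UNIV. (Aop x i - Aop y i)\<^sup>2)"
proof -
  obtain u where u: "u \<in> Bprod F" "Aop u = Aop x"
    "(\<Sum>r\<in>UNIV. \<Sum>i\<in>UNIV. w i * (u r i - y r i)\<^sup>2)
       \<le> sum w UNIV * (\<Sum>i\<in>UNIV. \<bar>Aop x i - Aop y i\<bar>)\<^sup>2 / 2"
    by (rule Bprod_error_bound_abs[OF sub F0 y x w])
  have "(\<Sum>i\<in>UNIV. \<bar>Aop x i - Aop y i\<bar>)\<^sup>2 \<le> (\<Sum>i\<in>UNIV. \<bar>Aop x i - Aop y i\<bar>\<^sup>2) * real CARD('n)"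
    by (rule sum_squared_le_sum_of_squares)
  then have "sum w UNIV / 2 * (\<Sum>i\<in>UNIV. \<bar>Aop x i - Aop y i\<bar>)\<^sup>2
      \<le> sum w UNIV / 2 * ((\<Sum>i\<in>UNIV. (Aop x i - Aop y i)\<^sup>2) * real CARD('n))"
    using w by (intro mult_left_mono) (auto intro: sum_nonneg)
  then show thesis
    using u by (intro that[of u]) (auto simp: algebra_simps)
qed

section \<open>The minimizer of the Lovasz objective\<close>

text \<open>Compactness bounds the set under \<open>Sup\<close>, so the supremum really is an upper
  bound.\<close>

lemma lovasz_upper:
  assumes "u \<in> base_polytope F"
  shows "(\<Sum>i\<in>UNIV. u i * x i) \<le> lovasz F x"
proof -
  have "continuous_on (base_polytope F) (\<lambda>u. \<Sum>i\<in>UNIV. u i * x i)"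
    by (intro continuous_intros continuous_on_coordinate)
  then have "bounded ((\<lambda>u. \<Sum>i\<in>UNIV. u i * x i) ` base_polytope F)"
    by (intro compact_imp_bounded compact_continuous_image compact_base_polytope)
  then show ?thesis
    unfolding lovasz_def Setcompr_eq_image using assms
    by (intro cSup_upper bounded_imp_bdd_above) auto
qed

text \<open>If \<xi> minimizes the squared norm of Aop over Bprod F and s = Aop \<xi>, then
  each \<xi> r attains the maximum defining the Lovasz extension at -s. Hence the objective at x
  exceeds the one at -s by at least half the squared distance of x to -s.\<close>

lemma xstar_optimal_point:
  fixes F :: "'r::finite \<Rightarrow> 'n::finite set \<Rightarrow> real"
  assumes sub: "\<And>r. submodular (F r)" and F0: "\<And>r. F r {} = 0"
  obtains \<xi> where "\<xi> \<in> Xi F"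
    "\<And>z. z \<in> Bprod F \<Longrightarrow> (\<Sum>i\<in>UNIV. xstar F i * (Aop z i - Aop \<xi> i)) \<le> 0"
proof -
  obtain \<xi> where \<xi>: "\<xi> \<in> Bprod F"
    and "\<And>z. z \<in> Bprod F \<Longrightarrow> penalty 0 1 (\<lambda>_ _. 0) (\<lambda>_. 0) \<xi> \<le> penalty 0 1 (\<lambda>_ _. 0) (\<lambda>_. 0) z"
    and opt: "\<And>r z. z \<in> base_polytope (F r) \<Longrightarrow>
       0 \<le> (\<Sum>i\<in>UNIV. (0 * (\<xi> r i - 0) + 1 * (Aop \<xi> i - 0)) * (z i - \<xi> r i))"
    using penalty_minimizer[of F 0 1 "\<lambda>_ _. 0" "\<lambda>_. 0", OF sub F0] by blast
  define s where "s = Aop \<xi>"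
  have \<xi>r: "\<xi> r \<in> base_polytope (F r)" for r using \<xi> by (simp add: Bprod_def)
  have opt: "0 \<le> (\<Sum>i\<in>UNIV. s i * (z i - \<xi> r i))" if "z \<in> base_polytope (F r)" for r z
    using opt[OF that] by (simp add: s_def)
  have sum_\<xi>: "(\<Sum>r\<in>UNIV. \<Sum>i\<in>UNIV. \<xi> r i * x i) = (\<Sum>i\<in>UNIV. s i * x i)" for x
    unfolding s_def Aop_def sum_distrib_right by (rule sum.swap)
  define obj where "obj x = (\<Sum>r\<in>UNIV. lovasz (F r) x) + (\<Sum>i\<in>UNIV. (x i)\<^sup>2) / 2" for x
  have "lovasz (F r) (- s) \<le> (\<Sum>i\<in>UNIV. \<xi> r i * (- s) i)" for r
    unfolding lovasz_def
  proof (rule cSup_least)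
    show "{\<Sum>i\<in>UNIV. u i * (- s) i |u. u \<in> base_polytope (F r)} \<noteq> {}"
      using \<xi>r by blast
  next
    fix c assume "c \<in> {\<Sum>i\<in>UNIV. u i * (- s) i |u. u \<in> base_polytope (F r)}"
    then obtain u where u: "u \<in> base_polytope (F r)" "c = (\<Sum>i\<in>UNIV. u i * (- s) i)" by blast
    show "c \<le> (\<Sum>i\<in>UNIV. \<xi> r i * (- s) i)"
      using opt[OF u(1)] unfolding u(2)
      by (simp add: algebra_simps sum_subtractf sum_negf)
  qed
  then have "(\<Sum>r\<in>UNIV. lovasz (F r) (- s)) \<le> (\<Sum>r\<in>UNIV. \<Sum>i\<in>UNIV. \<xi> r i * (- s) i)"
    by (rule sum_mono)
  then have le: "obj (- s) \<le> - (\<Sum>i\<in>UNIV. (s i)\<^sup>2) / 2"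
    unfolding obj_def sum_\<xi> by (simp add: sum_negf power2_eq_square)
  \<comment> \<open>Completing the square, with the Lovasz sum at x bounded below by <s, x>. The
    quadratic growth gives minimality and uniqueness together, as the \<open>THE\<close> in
    \<open>xstar\<close> requires.\<close>
  have ge: "obj (- s) + (\<Sum>i\<in>UNIV. (x i + s i)\<^sup>2) / 2 \<le> obj x" for x
  proof -
    have "(\<Sum>i\<in>UNIV. s i * x i) \<le> (\<Sum>r\<in>UNIV. lovasz (F r) x)"
      unfolding sum_\<xi>[symmetric] by (intro sum_mono lovasz_upper \<xi>r)
    moreover have "(\<Sum>i\<in>UNIV. (x i + s i)\<^sup>2) = (\<Sum>i\<in>UNIV. (x i)\<^sup>2) + 2 * (\<Sum>i\<in>UNIV. s i * x i) + (\<Sum>i\<in>UNIV. (s i)\<^sup>2)"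
      by (simp add: sum_distrib_left flip: sum.distrib) (simp add: power2_eq_square algebra_simps)
    ultimately show ?thesis
      unfolding obj_def[of x] using le by linarith
  qed
  have "xstar F = - s"
    unfolding xstar_def obj_def[symmetric]
  proof (rule the_equality)
    show "\<forall>x'. obj (- s) \<le> obj x'"
    proof
      fix x
      have "0 \<le> (\<Sum>i\<in>UNIV. (x i + s i)\<^sup>2)" by (intro sum_nonneg) auto
      then show "obj (- s) \<le> obj x" using ge[of x] by linarith
    qed
  next
    fix x assume "\<forall>x'. obj x \<le> obj x'"
    then have "obj x \<le> obj (- s)" by blast
    then have "(\<Sum>i\<in>UNIV. (x i + s i)\<^sup>2) \<le> 0"
      using ge[of x] by linarith
    then have "(\<Sum>i\<in>UNIV. (x i + s i)\<^sup>2) = 0"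
      by (intro antisym sum_nonneg) auto
    then have "\<forall>i. x i + s i = 0"
      by (subst (asm) sum_nonneg_eq_0_iff) auto
    then show "x = - s" by (auto simp: fun_eq_iff add_eq_0_iff2)
  qed
  moreover have "0 \<le> (\<Sum>i\<in>UNIV. s i * (Aop z i - Aop \<xi> i))" if "z \<in> Bprod F" for z
  proof -
    have "0 \<le> (\<Sum>r\<in>UNIV. \<Sum>i\<in>UNIV. s i * (z r i - \<xi> r i))"
      by (rule sum_nonneg) (rule opt, use that in \<open>simp add: Bprod_def\<close>)
    also have "\<dots> = (\<Sum>i\<in>UNIV. s i * (Aop z i - Aop \<xi> i))"
      unfolding Aop_def sum_subtractf[symmetric] sum_distrib_left by (rule sum.swap)
    finally show ?thesis .
  qed
  ultimately show thesis
    using \<xi> by (intro that[of \<xi>]) (auto simp: Xi_def s_def sum_negf)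
qed

section \<open>Weighted norms and distances\<close>

lemma Inorm_sq:
  assumes "\<And>i. 0 \<le> w i"
  shows "(Inorm w u)\<^sup>2 = (\<Sum>r\<in>UNIV. \<Sum>i\<in>UNIV. w i * (u r i)\<^sup>2)"
  using assms by (simp add: Inorm_def wnorm_def sum_nonneg)

lemma Inorm_nonneg: "0 \<le> Inorm w u"
  unfolding Inorm_def by (intro real_sqrt_ge_zero sum_nonneg) auto

text \<open>Rescaling the entries turns \<open>Inorm\<close> into a Euclidean norm over pairs, from
  which the triangle inequality is inherited.\<close>

lemma Inorm_L2_set:
  assumes "\<And>i. 0 \<le> w i"
  shows "Inorm w u = L2_set (\<lambda>(r, i). sqrt (w i) * u r i) UNIV"
proof -
  have "(L2_set (\<lambda>(r, i). sqrt (w i) * u r i) UNIV)\<^sup>2 = (\<Sum>(r, i)\<in>UNIV \<times> UNIV. w i * (u r i)\<^sup>2)"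
    using assms by (simp add: L2_set_def sum_nonneg power_mult_distrib case_prod_unfold)
  also have "\<dots> = (Inorm w u)\<^sup>2"
    unfolding Inorm_sq[OF assms] by (rule sum.cartesian_product[symmetric])
  finally show ?thesis by (metis Inorm_nonneg L2_set_nonneg power2_eq_imp_eq)
qed

lemma Inorm_triangle:
  fixes x y z :: "'r::finite \<Rightarrow> 'n::finite \<Rightarrow> real"
  assumes "\<And>i. 0 \<le> w i"
  shows "Inorm w (x - z) \<le> Inorm w (x - y) + Inorm w (y - z)"
proof -
  define f where "f u = (\<lambda>(r, i). sqrt (w i) * u r i)" for u :: "'r \<Rightarrow> 'n \<Rightarrow> real"
  have norm: "Inorm w u = L2_set (f u) UNIV" for u
    unfolding f_def by (rule Inorm_L2_set[OF assms])
  have "f (x - z) = (\<lambda>p. f (x - y) p + f (y - z) p)"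
    by (auto simp: f_def fun_eq_iff algebra_simps)
  then show ?thesis
    unfolding norm by (simp only: L2_set_triangle_ineq)
qed

lemma Idist_le: "z \<in> K \<Longrightarrow> Idist w y K \<le> Inorm w (y - z)"
  unfolding Idist_def by (intro cInf_lower bdd_belowI[of _ 0]) (auto simp: Inorm_nonneg)

lemma Idist_greatest:
  "K \<noteq> {} \<Longrightarrow> (\<And>z. z \<in> K \<Longrightarrow> c \<le> Inorm w (y - z)) \<Longrightarrow> c \<le> Idist w y K"
  unfolding Idist_def by (intro cInf_greatest) auto

lemma Idist_nonneg: "K \<noteq> {} \<Longrightarrow> 0 \<le> Idist w y K"
  by (intro Idist_greatest) (auto simp: Inorm_nonneg)

lemma Idist_triangle:
  assumes "\<And>i. 0 \<le> w i" "K \<noteq> {}"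
  shows "Idist w x K \<le> Inorm w (x - y) + Idist w y K"
proof -
  have "Idist w x K - Inorm w (x - y) \<le> Idist w y K"
  proof (rule Idist_greatest[OF assms(2)])
    fix z assume "z \<in> K"
    then have "Idist w x K \<le> Inorm w (x - z)" by (rule Idist_le)
    also have "\<dots> \<le> Inorm w (x - y) + Inorm w (y - z)" using assms(1) by (rule Inorm_triangle)
    finally show "Idist w x K - Inorm w (x - y) \<le> Inorm w (y - z)" by linarith
  qed
  then show ?thesis by linarith
qed

text \<open>Taking the infimum over z turns the decrease into one of the squared distance, and
  \<open>le\<close> makes e^2 at least the fraction 1/\<kappa>^2 of the squared distance of
  p.\<close>

lemma Idist_contraction:
  assumes K: "K \<noteq> {}" and \<kappa>: "0 < \<kappa>" and e: "0 \<le> e"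
    and decr: "\<And>z. z \<in> K \<Longrightarrow> (Inorm w (q - z))\<^sup>2 + e\<^sup>2 \<le> (Inorm w (p - z))\<^sup>2"
    and le: "Idist w p K \<le> \<kappa> * e"
  shows "(Idist w q K)\<^sup>2 \<le> (1 - 1 / \<kappa>\<^sup>2) * (Idist w p K)\<^sup>2"
proof -
  have "sqrt ((Idist w q K)\<^sup>2 + e\<^sup>2) \<le> Idist w p K"
  proof (rule Idist_greatest[OF K])
    fix z assume z: "z \<in> K"
    have "(Idist w q K)\<^sup>2 \<le> (Inorm w (q - z))\<^sup>2"
      using Idist_le[OF z] Idist_nonneg[OF K] by (intro power_mono)
    then show "sqrt ((Idist w q K)\<^sup>2 + e\<^sup>2) \<le> Inorm w (p - z)"
      using decr[OF z] by (intro real_le_lsqrt) (auto simp: Inorm_nonneg)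
  qed
  then have "(Idist w q K)\<^sup>2 + e\<^sup>2 \<le> (Idist w p K)\<^sup>2"
    by (rule sqrt_le_D)
  moreover have "(Idist w p K)\<^sup>2 \<le> \<kappa>\<^sup>2 * e\<^sup>2"
    using power_mono[OF le Idist_nonneg[OF K], of 2] by (simp add: power_mult_distrib)
  then have "(Idist w p K)\<^sup>2 / \<kappa>\<^sup>2 \<le> e\<^sup>2"
    using \<kappa> by (simp add: pos_divide_le_eq mult.commute)
  ultimately show ?thesis by (simp add: algebra_simps)
qed

text \<open>Members of \<open>Bprod F\<close> belong to \<open>Xi F\<close> as soon as
  \<open>Aop\<close> agrees with a known point of \<open>Xi F\<close>, so the point supplied by the
  error bound lies there.\<close>

lemma Xi_error_bound:
  fixes F :: "'r::finite \<Rightarrow> 'n::finite set \<Rightarrow> real"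
  assumes sub: "\<And>r. submodular (F r)" and F0: "\<And>r. F r {} = 0"
    and w: "\<And>i. 0 \<le> w i" and y: "y \<in> Bprod F"
  shows "Idist w y (Xi F) \<le> sqrt (real CARD('n) * sum w UNIV / 2) * sqrt (\<Sum>i\<in>UNIV. (Aop y i + xstar F i)\<^sup>2)"
proof -
  obtain \<xi> where \<xi>: "\<xi> \<in> Xi F" by (rule xstar_optimal_point[OF sub F0])
  then have "\<xi> \<in> Bprod F" "Aop \<xi> = - xstar F" by (auto simp: Xi_def)
  obtain u where u: "u \<in> Bprod F" "Aop u = Aop \<xi>"
    and le: "(\<Sum>r\<in>UNIV. \<Sum>i\<in>UNIV. w i * (u r i - y r i)\<^sup>2)
       \<le> real CARD('n) * sum w UNIV / 2 * (\<Sum>i\<in>UNIV. (Aop \<xi> i - Aop y i)\<^sup>2)"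
    by (rule Bprod_error_bound[OF sub F0 y \<open>\<xi> \<in> Bprod F\<close> w])
  have "(Inorm w (y - u))\<^sup>2 = (\<Sum>r\<in>UNIV. \<Sum>i\<in>UNIV. w i * (u r i - y r i)\<^sup>2)"
    by (simp add: Inorm_sq[OF w] power2_commute)
  also note le
  also have "(\<Sum>i\<in>UNIV. (Aop \<xi> i - Aop y i)\<^sup>2) = (\<Sum>i\<in>UNIV. (Aop y i + xstar F i)\<^sup>2)"
    by (simp add: \<open>Aop \<xi> = - xstar F\<close>) (simp add: power2_eq_square algebra_simps)
  finally have "Inorm w (y - u) \<le> sqrt (real CARD('n) * sum w UNIV / 2 * (\<Sum>i\<in>UNIV. (Aop y i + xstar F i)\<^sup>2))"
    by (rule real_le_rsqrt)
  moreover have "Idist w y (Xi F) \<le> Inorm w (y - u)"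
    using u \<open>Aop \<xi> = - xstar F\<close> by (intro Idist_le) (auto simp: Xi_def)
  ultimately show ?thesis by (simp flip: real_sqrt_mult)
qed

section \<open>One round of the iteration\<close>

lemma sum_incident_const:
  "(\<Sum>r\<in>UNIV. if i \<in> incset (F r) then c else 0) = real (mult F i) * (c :: real)"
  by (simp add: sum.If_cases mult_def)

text \<open>Cauchy-Schwarz over the \<open>mult F i\<close> blocks incident to i. With these weights
  \<open>Aop\<close> does not increase norms on vectors of incidence support.\<close>

lemma power2_Aop_le:
  assumes "\<And>r. i \<notin> incset (F r) \<Longrightarrow> u r i = 0"
  shows "(Aop u i)\<^sup>2 \<le> (\<Sum>r\<in>UNIV. real (mult F i) * (u r i)\<^sup>2)"
proof -
  define R where "R = {r. i \<in> incset (F r)}"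
  have restrict: "(\<Sum>r\<in>UNIV. g r) = (\<Sum>r\<in>R. g r)" if "\<And>r. r \<notin> R \<Longrightarrow> g r = 0" for g :: "'a \<Rightarrow> real"
    using that by (intro sum.mono_neutral_right) auto
  have "Aop u i = (\<Sum>r\<in>R. u r i)"
    unfolding Aop_def using assms by (intro restrict) (auto simp: R_def)
  then have "(Aop u i)\<^sup>2 \<le> (\<Sum>r\<in>R. (u r i)\<^sup>2) * real (card R)"
    using sum_squared_le_sum_of_squares[of "\<lambda>r. u r i" R] by simp
  also have "(\<Sum>r\<in>R. (u r i)\<^sup>2) = (\<Sum>r\<in>UNIV. (u r i)\<^sup>2)"
    using assms by (intro restrict[symmetric]) (auto simp: R_def)
  finally show ?thesis
    unfolding sum_distrib_left[symmetric] by (simp add: mult_def R_def mult.commute)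
qed

lemma rate_nonneg: "0 \<le> \<rho> \<Longrightarrow> 0 \<le> 1 - 1 / (\<rho> + 1 :: real)\<^sup>2"
  by (simp add: one_le_power)

text \<open>The exact projection b of y onto the vectors with incidence support and Aop b = -xstar
  differs from the next iterate a by a shift orthogonal to the space Aset.
  It serves only for the analysis, since it involves the unknown xstar.\<close>

lemma IAP_step:
  fixes F :: "'r::finite \<Rightarrow> 'n::finite set \<Rightarrow> real"
  defines "w \<equiv> \<lambda>i. real (mult F i)"
  defines "\<kappa> \<equiv> sqrt (real CARD('n) * sum w UNIV / 2) + 1"
  assumes sub: "\<And>r. submodular (F r)" and F0: "\<And>r. F r {} = 0"
    and mu_pos: "\<And>i. 1 \<le> mult F i"
    and y: "y \<in> Bprod F"
    and a: "\<And>r i. a r i = (if i \<in> incset (F r) then y r i - Aop y i / w i else 0)"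
    and q: "\<And>r. q r = wproj (base_polytope (F r)) w (a r)"
  shows "Idist w q (Xi F) \<le> (1 - 1 / \<kappa>\<^sup>2) * Idist w y (Xi F)"
proof -
  have w: "0 < w i" for i using mu_pos[of i] by (simp add: w_def)
  then have w0: "0 \<le> w i" for i by (rule less_imp_le)
  define \<rho> where "\<rho> = sqrt (real CARD('n) * sum w UNIV / 2)"
  have \<rho>: "0 \<le> \<rho>" unfolding \<rho>_def using w0 by (intro real_sqrt_ge_zero divide_nonneg_nonneg mult_nonneg_nonneg sum_nonneg) auto
  have \<kappa>: "\<kappa> = \<rho> + 1" by (simp add: \<kappa>_def \<rho>_def)
  define s where "s = - xstar F"
  obtain \<xi>0 where \<xi>0: "\<xi>0 \<in> Xi F"
    and opt: "\<And>z. z \<in> Bprod F \<Longrightarrow> (\<Sum>i\<in>UNIV. xstar F i * (Aop z i - Aop \<xi>0 i)) \<le> 0"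
    using xstar_optimal_point[of F, OF sub F0] by blast
  have ne: "Xi F \<noteq> {}" using \<xi>0 by blast
  have Xi: "\<xi> \<in> Bprod F" "Aop \<xi> = s" if "\<xi> \<in> Xi F" for \<xi>
    using that by (auto simp: Xi_def s_def)
  have supp: "z r i = 0" if "z \<in> Bprod F" "i \<notin> incset (F r)" for z r i
    using that base_polytope_nonincident[of "F r" "z r" i] F0 by (auto simp: Bprod_def)
  have opt: "0 \<le> (\<Sum>i\<in>UNIV. s i * (Aop z i - s i))" if "z \<in> Bprod F" for z
    using opt[OF that] Xi(2)[OF \<xi>0] by (simp add: s_def sum_negf)
  have err: "Idist w z (Xi F) \<le> \<rho> * sqrt (\<Sum>i\<in>UNIV. (Aop z i - s i)\<^sup>2)" if "z \<in> Bprod F" for z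
    using Xi_error_bound[of F w z, OF sub F0 w0 that] by (simp add: \<rho>_def s_def)
  define d where "d i = Aop y i - s i" for i
  \<comment> \<open>The residual d i is spread evenly over the blocks incident to i.\<close>
  define b where "b r i = (if i \<in> incset (F r) then y r i - d i / w i else 0)" for r i
  have b: "b r i = y r i - (if i \<in> incset (F r) then d i / w i else 0)" for r i
    using supp[OF y] by (simp add: b_def)
  have Ab: "Aop b i = s i" for i
  proof -
    have "Aop b i = Aop y i - w i * (d i / w i)"
      unfolding Aop_def b sum_subtractf sum_incident_const by (simp add: w_def)
    then show ?thesis using w[of i] by (simp add: d_def)
  qed

  \<comment> \<open>First projection, from y to b. The correction is constant over the incident
    blocks, so its product with b - \<xi> vanishes because \<open>Aop b\<close> and
    \<open>Aop \<xi>\<close> agree; its squared norm is that of d.\<close>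
  have pythagoras: "(Inorm w (b - \<xi>))\<^sup>2 + (sqrt (\<Sum>i\<in>UNIV. (d i)\<^sup>2))\<^sup>2 \<le> (Inorm w (y - \<xi>))\<^sup>2"
    if \<xi>: "\<xi> \<in> Xi F" for \<xi>
  proof -
    have "(\<Sum>r\<in>UNIV. w i * (y r i - \<xi> r i)\<^sup>2) = (\<Sum>r\<in>UNIV. w i * (b r i - \<xi> r i)\<^sup>2) + (d i)\<^sup>2" for i
    proof -
      have "w i * (y r i - \<xi> r i)\<^sup>2 = w i * (b r i - \<xi> r i)\<^sup>2 + 2 * d i * (b r i - \<xi> r i)
          + (if i \<in> incset (F r) then (d i)\<^sup>2 / w i else 0)" for r
      proof (cases "i \<in> incset (F r)")
        case True
        define e where "e = d i / w i"
        have e: "d i = w i * e" "(d i)\<^sup>2 / w i = w i * e\<^sup>2" "y r i = b r i + e"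
          using True w[of i] by (simp_all add: e_def b_def power2_eq_square)
        show ?thesis
          unfolding e(2,3) using True by (simp add: e(1)) (simp add: power2_eq_square algebra_simps)
      next
        case False
        then show ?thesis using supp[OF y] supp[OF Xi(1)[OF \<xi>]] by (simp add: b_def)
      qed
      then have "(\<Sum>r\<in>UNIV. w i * (y r i - \<xi> r i)\<^sup>2) = (\<Sum>r\<in>UNIV. w i * (b r i - \<xi> r i)\<^sup>2)
          + 2 * d i * (Aop b i - Aop \<xi> i) + w i * ((d i)\<^sup>2 / w i)"
        by (simp add: sum.distrib sum_incident_const w_def Aop_def sum_subtractf flip: sum_distrib_left)
      then show ?thesis using Ab Xi(2)[OF \<xi>] w[of i] by simp
    qed
    then have "(\<Sum>i\<in>UNIV. \<Sum>r\<in>UNIV. w i * (y r i - \<xi> r i)\<^sup>2)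
        = (\<Sum>i\<in>UNIV. \<Sum>r\<in>UNIV. w i * (b r i - \<xi> r i)\<^sup>2) + (\<Sum>i\<in>UNIV. (d i)\<^sup>2)"
      by (simp add: sum.distrib)
    then show ?thesis
      unfolding Inorm_sq[OF w0] minus_apply
      by (subst (1 2) sum.swap) (simp add: sum_nonneg)
  qed
  have "Idist w y (Xi F) \<le> \<rho> * sqrt (\<Sum>i\<in>UNIV. (d i)\<^sup>2)"
    using err[OF y] by (simp add: d_def)
  also have "\<dots> \<le> \<kappa> * sqrt (\<Sum>i\<in>UNIV. (d i)\<^sup>2)"
    unfolding \<kappa> by (intro mult_right_mono) (auto simp: sum_nonneg)
  finally have step1: "(Idist w b (Xi F))\<^sup>2 \<le> (1 - 1 / \<kappa>\<^sup>2) * (Idist w y (Xi F))\<^sup>2"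
    using \<rho> \<kappa> by (intro Idist_contraction[OF ne _ _ pythagoras]) (auto simp: sum_nonneg)

  have qB: "q \<in> Bprod F"
    unfolding Bprod_def q by (intro CollectI allI wproj_mem sub F0 w)
  \<comment> \<open>Second projection, from b to q. On incident entries b is a plus s/w; the shift
    contributes the term s (q - \<xi>), whose sum is nonnegative by the minimality of s, so q
    behaves like a projection of b.\<close>
  have obtuse: "(Inorm w (q - \<xi>))\<^sup>2 + (Inorm w (b - q))\<^sup>2 \<le> (Inorm w (b - \<xi>))\<^sup>2" if \<xi>: "\<xi> \<in> Xi F" for \<xi>
  proof -
    have "0 \<le> (\<Sum>r\<in>UNIV. \<Sum>i\<in>UNIV. w i * (q r i - a r i) * (\<xi> r i - q r i))"
      unfolding q using Xi(1)[OF \<xi>]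
      by (intro sum_nonneg[of UNIV "\<lambda>r. sum (f r) UNIV" for f] wproj_first_order sub F0 w) (auto simp: Bprod_def)
    moreover have "0 \<le> (\<Sum>r\<in>UNIV. \<Sum>i\<in>UNIV. s i * (q r i - \<xi> r i))"
    proof -
      have "(\<Sum>r\<in>UNIV. \<Sum>i\<in>UNIV. s i * (q r i - \<xi> r i)) = (\<Sum>i\<in>UNIV. s i * (Aop q i - Aop \<xi> i))"
        unfolding Aop_def sum_subtractf[symmetric] sum_distrib_left by (rule sum.swap)
      then show ?thesis using opt[OF qB] Xi(2)[OF \<xi>] by simp
    qed
    moreover have "w i * (b r i - \<xi> r i)\<^sup>2 = w i * (q r i - \<xi> r i)\<^sup>2 + w i * (b r i - q r i)\<^sup>2
        + 2 * (w i * (q r i - a r i) * (\<xi> r i - q r i)) + 2 * (s i * (q r i - \<xi> r i))" for r i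
    proof (cases "i \<in> incset (F r)")
      case True
      define e where "e = s i / w i"
      have e: "s i = w i * e" "b r i = a r i + e"
        using True w[of i] by (simp_all add: a b_def d_def e_def diff_divide_distrib)
      show ?thesis
        unfolding e by (simp add: power2_eq_square algebra_simps)
    next
      case False
      then show ?thesis using supp[OF qB] supp[OF Xi(1)[OF \<xi>]] by (simp add: b_def)
    qed
    ultimately show ?thesis
      unfolding Inorm_sq[OF w0] minus_apply by (simp add: sum.distrib flip: sum_distrib_left)
  qed
  have "(\<Sum>i\<in>UNIV. (Aop q i - s i)\<^sup>2) \<le> (Inorm w (b - q))\<^sup>2"
  proof -
    have "(Aop q i - s i)\<^sup>2 \<le> (\<Sum>r\<in>UNIV. w i * (q r i - b r i)\<^sup>2)" for i
    proof -
      have "(Aop (\<lambda>r i. q r i - b r i) i)\<^sup>2 \<le> (\<Sum>r\<in>UNIV. w i * (q r i - b r i)\<^sup>2)"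
        unfolding w_def using supp[OF qB] by (intro power2_Aop_le) (auto simp: b_def)
      then show ?thesis by (simp add: Aop_minus Ab)
    qed
    then have "(\<Sum>i\<in>UNIV. (Aop q i - s i)\<^sup>2) \<le> (\<Sum>i\<in>UNIV. \<Sum>r\<in>UNIV. w i * (q r i - b r i)\<^sup>2)"
      by (rule sum_mono)
    also have "\<dots> = (\<Sum>r\<in>UNIV. \<Sum>i\<in>UNIV. w i * (q r i - b r i)\<^sup>2)"
      by (rule sum.swap)
    finally show ?thesis
      by (simp add: Inorm_sq[OF w0] power2_commute)
  qed
  then have "sqrt (\<Sum>i\<in>UNIV. (Aop q i - s i)\<^sup>2) \<le> Inorm w (b - q)"
    by (intro real_le_lsqrt) (auto simp: Inorm_nonneg)
  then have "Idist w q (Xi F) \<le> \<rho> * Inorm w (b - q)"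
    using err[OF qB] mult_left_mono[OF _ \<rho>] by (meson order_trans)
  \<comment> \<open>The error bound holds at q, while b need not lie in \<open>Bprod F\<close>; the
    triangle inequality from b to q adds the 1 in \<kappa> = \<rho> + 1.\<close>
  then have "Idist w b (Xi F) \<le> \<kappa> * Inorm w (b - q)"
    using Idist_triangle[of w "Xi F" b q, OF w0 ne] by (simp add: \<kappa> algebra_simps)
  then have step2: "(Idist w q (Xi F))\<^sup>2 \<le> (1 - 1 / \<kappa>\<^sup>2) * (Idist w b (Xi F))\<^sup>2"
    using \<rho> \<kappa> by (intro Idist_contraction[OF ne _ _ obtuse]) (auto simp: Inorm_nonneg)

  have c: "0 \<le> 1 - 1 / \<kappa>\<^sup>2" unfolding \<kappa> by (rule rate_nonneg[OF \<rho>])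
  \<comment> \<open>Two contractions of the squared distance amount to one contraction of the
    distance itself by the same factor.\<close>
  have "(Idist w q (Xi F))\<^sup>2 \<le> (1 - 1 / \<kappa>\<^sup>2) * ((1 - 1 / \<kappa>\<^sup>2) * (Idist w y (Xi F))\<^sup>2)"
    using step2 mult_left_mono[OF step1 c] by linarith
  also have "\<dots> = ((1 - 1 / \<kappa>\<^sup>2) * Idist w y (Xi F))\<^sup>2"
    by (simp only: power2_eq_square mult.assoc mult.left_commute)
  finally show ?thesis
    by (rule power2_le_imp_le) (rule mult_nonneg_nonneg[OF c Idist_nonneg[OF ne]])
qed

section \<open>Geometric convergence over all rounds\<close>

theorem theorem3p5:
  fixes F :: "'r::finite \<Rightarrow> 'n::finite set \<Rightarrow> real"
    and a y :: "nat \<Rightarrow> 'r \<Rightarrow> 'n \<Rightarrow> real"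
  assumes sub: "\<And>r. submodular (F r)"
    and empty: "\<And>r. F r {} = 0"
    and mu_pos: "\<And>i. mult F i \<ge> 1"
    and a0: "a 0 \<in> Aset F"
    and yk: "\<And>k r. y k r = wproj (base_polytope (F r)) (\<lambda>i. real (mult F i)) (a k r)"
    and ak: "\<And>k r i. a (Suc k) r i =
               (if i \<in> incset (F r) then y k r i - Aop (y k) i / real (mult F i) else 0)"
  shows "\<forall>k. Idist (\<lambda>i. real (mult F i)) (y k) (Xi F)
           \<le> 2 * Idist (\<lambda>i. real (mult F i)) (y 0) (Xi F)
             * (1 - 1 / (sqrt (real (card (UNIV :: 'n set)) * real (\<Sum>i\<in>UNIV. mult F i) / 2) + 1)\<^sup>2) ^ k"
proof
  fix k
  define w where "w = (\<lambda>i. real (mult F i))"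
  define c where "c = 1 - 1 / (sqrt (real CARD('n) * real (\<Sum>i\<in>UNIV. mult F i) / 2) + 1)\<^sup>2"
  have w: "0 < w i" for i using mu_pos[of i] by (simp add: w_def)
  have yB: "y j \<in> Bprod F" for j
    unfolding Bprod_def yk w_def[symmetric] by (intro CollectI allI wproj_mem sub empty w)
  have c: "0 \<le> c"
    unfolding c_def by (intro rate_nonneg real_sqrt_ge_zero) (simp flip: of_nat_sum of_nat_mult)
  have D0: "0 \<le> Idist w (y 0) (Xi F)"
    using xstar_optimal_point[of F, OF sub empty] by (metis Idist_nonneg empty_iff)
  have step: "Idist w (y (Suc j)) (Xi F) \<le> c * Idist w (y j) (Xi F)" for j
    unfolding w_def c_def of_nat_sum
    by (rule IAP_step[OF sub empty mu_pos yB ak yk])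
  have "Idist w (y k) (Xi F) \<le> Idist w (y 0) (Xi F) * c ^ k"
  proof (induction k)
    case (Suc k)
    have "Idist w (y (Suc k)) (Xi F) \<le> c * (Idist w (y 0) (Xi F) * c ^ k)"
      using step[of k] mult_left_mono[OF Suc c] by linarith
    then show ?case by (simp add: algebra_simps)
  qed simp
  \<comment> \<open>The factor 2 enters here, by nonnegativity of the initial distance and of the
    rate.\<close>
  also have "\<dots> \<le> 2 * Idist w (y 0) (Xi F) * c ^ k"
    using D0 c by (intro mult_right_mono) auto
  finally show "Idist (\<lambda>i. real (mult F i)) (y k) (Xi F)
      \<le> 2 * Idist (\<lambda>i. real (mult F i)) (y 0) (Xi F)
        * (1 - 1 / (sqrt (real (card (UNIV :: 'n set)) * real (\<Sum>i\<in>UNIV. mult F i) / 2) + 1)\<^sup>2) ^ k"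
    by (simp only: w_def c_def)
qed

end
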